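(* For any decision points $(d_1,d_2,d_3)\in(0,1)^3$, the triangle process has at most four periodic orbits.
   Context: Triangle process. Fix $\lambda_1,\lambda_2,\lambda_3>0$, $\mu_1,\mu_2,\mu_3>0$ with $\rho_i:=\lambda_i/\mu_i<1$ for each $i$ and $\rho_1+\rho_2+\rho_3>1$. Put $\theta_j:=\mu_j^{-1}(\lambda_1+\lambda_2+\lambda_3)-1$. Let $e_1,e_2,e_3$ be the standard basis of $\mathbb R^3$, $A_i^0:=\{y\in\mathbb R^3: y_1+y_2+y_3=1,\ y_i=0,\ y_l\ge0\ \forall l\}$ and $A^0:=A_1^0\cup A_2^0\cup A_3^0$. For $j\in\{1,2,3\}$ and $z\in A^0\setminus A_j^0$ let $f_j(z):=\sum_{i\neq j}\frac{(\mu_j-\lambda_j)z_i+\lambda_i z_j}{(\mu_j-\lambda_j)+\mu_j\theta_j z_j}\,e_i\in A_j^0$. Let $(\hat i,\hat j,\hat k)$ denote $(1,2,3)$ or one of its cyclic permutations; the point $(1-x)e_{\hat j}+xe_{\hat k}\in A^0_{\hat i}$, $x\in[0,1]$, is written $(x,\hat i)$. Decision points are numbers $d_1,d_2,d_3\in(0,1)$, identified with the points $(d_{\hat i},\hat i)$. The switching rule is $\mathfrak R((x,\hat i))=\hat j$ if $x<d_{\hat i}$, $=\hat k$ if $x>d_{\hat i}$, and both values are allowed if $x=d_{\hat i}$. The (possibly two-valued) map is $\varphi(z):=f_{\mathfrak R(z)}(z)$. A periodic orbit is a finite sequence $u_1,\dots,u_m$ of points of $A^0$ with $u_{n+1}\in\varphi(u_n)$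 for $n<m$ and $u_1\in\varphi(u_m)$; orbits differing by a cyclic shift are identified.
   Formalization: A periodic orbit is required to consist of pairwise distinct points, since otherwise repeating one orbit several times would give infinitely many different finite sequences. *)

theory Defs
  imports "HOL-Analysis.Analysis" "HOL-Library.Numeral_Type"
begin

text \<open>Coordinates of R^3 are indexed by the type 3 = Z/3Z; the paper's indices 1,2,3
  correspond to 1,2,3 (=0) and the cyclic permutations (i,j,k) of (1,2,3) are exactly
  (i, i+1, i+2).\<close>

definition A0i :: "3 \<Rightarrow> (real^3) set" where
  "A0i i = {y. (\<Sum>l\<in>UNIV. y$l) = 1 \<and> y$i = 0 \<and> (\<forall>l. y$l \<ge> 0)}"

definition A0 :: "(real^3) set" where
  "A0 = (\<Union>i. A0i i)"

definition theta :: "real^3 \<Rightarrow> real^3 \<Rightarrow> 3 \<Rightarrow> real" where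
  "theta lam mu j = (\<Sum>l\<in>UNIV. lam$l) / mu$j - 1"

definition fmap :: "real^3 \<Rightarrow> real^3 \<Rightarrow> 3 \<Rightarrow> real^3 \<Rightarrow> real^3" where
  "fmap lam mu j z = (\<chi> i. if i = j then 0 else
      ((mu$j - lam$j) * z$i + lam$i * z$j) / ((mu$j - lam$j) + mu$j * theta lam mu j * z$j))"

definition side_pt :: "real \<Rightarrow> 3 \<Rightarrow> real^3" where
  "side_pt x i = (\<chi> l. if l = i + 1 then 1 - x else if l = i + 2 then x else 0)"

definition rule_allows :: "real^3 \<Rightarrow> real^3 \<Rightarrow> 3 \<Rightarrow> bool" where
  "rule_allows d z j \<longleftrightarrow> (\<exists>i x. 0 \<le> x \<and> x \<le> 1 \<and> z = side_pt x i \<and>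
      ((x < d$i \<and> j = i + 1) \<or> (x > d$i \<and> j = i + 2) \<or> (x = d$i \<and> (j = i + 1 \<or> j = i + 2))))"

definition phi_step :: "real^3 \<Rightarrow> real^3 \<Rightarrow> real^3 \<Rightarrow> real^3 \<Rightarrow> real^3 \<Rightarrow> bool" where
  "phi_step lam mu d z w \<longleftrightarrow> z \<in> A0 \<and> (\<exists>j. rule_allows d z j \<and> z \<notin> A0i j \<and> w = fmap lam mu j z)"

definition periodic_orbit :: "real^3 \<Rightarrow> real^3 \<Rightarrow> real^3 \<Rightarrow> (real^3) list \<Rightarrow> bool" where
  "periodic_orbit lam mu d us \<longleftrightarrow> us \<noteq> [] \<and> distinct us \<and> set us \<subseteq> A0 \<and>
     (\<forall>n. Suc n < length us \<longrightarrow> phi_step lam mu d (us!n) (us!Suc n)) \<and>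
     phi_step lam mu d (last us) (hd us)"

end

theory Submission
  imports Defs
begin

text \<open>Measure a point in the interior of a side by the ratio of its two positive coordinates. Each
  service map sends this ratio t to a/(bt + c) or (b/t + c)/a with positive a, b, c, so on each arc
  where the server's choice is fixed it reverses the order and strictly shrinks quotients of ratios.
  The map is injective backwards in time, hence distinct periodic orbits are disjoint. Given finitely
  many orbits, join two of them by an edge when they own neighbouring points of some side. A pair of
  neighbours whose next service agrees is mapped to another pair of neighbours with a smaller quotient
  of ratios, so every edge is realised by a pair of neighbours around a decision point, which leaves at
  most three edges. Every orbit visits two of the three sides, so any two orbits meet a common side and
  the graph is connected; therefore it has at most four vertices.\<close>

section \<open>Connected graphs\<close>

text \<open>Connectedness enters through cuts: every proper nonempty \<open>C\<close> is left by an
  edge. When \<open>C\<close> grows along such edges, each new vertex brings an edge that lies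
  inside the new set but not inside the old one. Members of \<open>E\<close> that are not edges
  between vertices, such as singletons, can only enlarge the bound.\<close>

lemma card_le_Suc_card_edges:
  fixes V :: "'a set" and E :: "'a set set"
  assumes "finite V" "finite E"
    and cut: "\<And>C. C \<subseteq> V \<Longrightarrow> C \<noteq> {} \<Longrightarrow> C \<noteq> V \<Longrightarrow> \<exists>a\<in>C. \<exists>b\<in>V - C. {a, b} \<in> E"
  shows "card V \<le> Suc (card E)"
proof -
  have grow: "n < card V \<Longrightarrow> \<exists>C\<subseteq>V. card C = Suc n \<and> n \<le> card {e \<in> E. e \<subseteq> C}" for n
  proof (induction n)
    case 0
    then obtain v where "v \<in> V" by fastforce
    then show ?case by (intro exI[of _ "{v}"]) auto
  next
    case (Suc n)
    then obtain C where C: "C \<subseteq> V" "card C = Suc n" "n \<le> card {e \<in> E. e \<subseteq> C}" by auto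
    with Suc.prems have "C \<noteq> {}" "C \<noteq> V" by auto
    from cut[OF C(1) this] obtain a b where ab: "a \<in> C" "b \<in> V" "b \<notin> C" "{a, b} \<in> E" by auto
    have fin: "finite C" using C(1) assms(1) finite_subset by blast
    have "insert {a, b} {e \<in> E. e \<subseteq> C} \<subseteq> {e \<in> E. e \<subseteq> insert b C}" using ab by auto
    then have "card (insert {a, b} {e \<in> E. e \<subseteq> C}) \<le> card {e \<in> E. e \<subseteq> insert b C}"
      using assms(2) by (intro card_mono) auto
    moreover have "card (insert {a, b} {e \<in> E. e \<subseteq> C}) = Suc (card {e \<in> E. e \<subseteq> C})"
      using ab assms(2) by (subst card_insert_disjoint) auto
    ultimately show ?case
      using C ab fin by (intro exI[of _ "insert b C"]) auto
  qed
  show ?thesis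
  proof (cases "card V")
    case (Suc n)
    then obtain C where "n \<le> card {e \<in> E. e \<subseteq> C}" using grow[of n] by auto
    also have "\<dots> \<le> card E" using assms(2) by (intro card_mono) auto
    finally show ?thesis using Suc by simp
  qed simp
qed

section \<open>Indices modulo three\<close>

lemma exhaust_cyclic_3:
  fixes i j :: 3
  shows "j = i \<or> j = i + 1 \<or> j = i + 2"
  using exhaust_3[of i] exhaust_3[of j] by auto

lemma all_cyclic_3:
  fixes i :: 3
  shows "(\<forall>l. Q l) \<longleftrightarrow> Q i \<and> Q (i + 1) \<and> Q (i + 2)"
  by (metis exhaust_cyclic_3)

lemma cyclic_3_distinct [simp]:
  fixes i :: 3
  shows "i + 1 \<noteq> i" "i + 2 \<noteq> i" "i + 1 \<noteq> i + 2" "i + 2 \<noteq> i + 1" "i \<noteq> i + 1" "i \<noteq> i + 2"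
  by simp_all

lemma cyclic_3_add [simp]:
  fixes i :: 3
  shows "i + 1 + 1 = i + 2" "i + 1 + 2 = i" "i + 2 + 1 = i" "i + 2 + 2 = i + 1"
  by (simp_all add: add.assoc)

lemma sum_cyclic_3:
  fixes i :: 3 and f :: "3 \<Rightarrow> real"
  shows "(\<Sum>l\<in>UNIV. f l) = f i + f (i + 1) + f (i + 2)"
proof -
  have "UNIV = {i, i + 1, i + 2}" using exhaust_cyclic_3[of _ i] by auto
  then have "sum f UNIV = sum f {i, i + 1, i + 2}" by (rule arg_cong)
  also have "\<dots> = f i + f (i + 1) + f (i + 2)" by (simp add: add.assoc)
  finally show ?thesis .
qed

section \<open>Order-reversing returns to three sides\<close>

text \<open>A set \<open>P\<close> of periodic points with successor \<open>nxt\<close>: \<open>side\<close> and \<open>pos\<close> locate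
  a point, \<open>orb\<close> is its orbit. The server's choice at \<open>p\<close> is \<open>side (nxt p)\<close>.\<close>

locale side_dynamics =
  fixes P :: "'a set" and nxt :: "'a \<Rightarrow> 'a" and side :: "'a \<Rightarrow> 3" and pos :: "'a \<Rightarrow> real"
    and orb :: "'a \<Rightarrow> 'b"
  assumes finite_P: "finite P"
    and nxt_image: "nxt ` P = P"
    and orb_nxt: "p \<in> P \<Longrightarrow> orb (nxt p) = orb p"
    and pos_gt_0: "p \<in> P \<Longrightarrow> 0 < pos p"
    and pos_inj: "\<lbrakk>p \<in> P; q \<in> P; side p = side q; pos p = pos q\<rbrakk> \<Longrightarrow> p = q"
    and side_nxt: "p \<in> P \<Longrightarrow> side (nxt p) = side p + 1 \<or> side (nxt p) = side p + 2"
    and side_nxt_mono: "\<lbrakk>p \<in> P; q \<in> P; side p = side q; pos p < pos q; side (nxt p) = side p + 2\<rbrakk>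
        \<Longrightarrow> side (nxt q) = side p + 2"
    and nxt_reverses: "\<lbrakk>p \<in> P; q \<in> P; side p = side q; side (nxt p) = side (nxt q); pos p < pos q\<rbrakk>
        \<Longrightarrow> pos (nxt q) < pos (nxt p)"
    and nxt_separates: "\<lbrakk>p \<in> P; q \<in> P; side (nxt p) = side (nxt q); side (nxt p) = side p + 1;
        side (nxt q) = side q + 2\<rbrakk> \<Longrightarrow> pos (nxt p) < pos (nxt q)"
    and nxt_contracts: "\<lbrakk>p \<in> P; q \<in> P; side p = side q; side (nxt p) = side (nxt q); pos p < pos q\<rbrakk>
        \<Longrightarrow> pos (nxt p) / pos (nxt q) < pos q / pos p"
begin

section \<open>Neighbouring points on a side\<close>

definition neighbours :: "'a \<Rightarrow> 'a \<Rightarrow> bool" where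
  "neighbours p q \<longleftrightarrow> p \<in> P \<and> q \<in> P \<and> side p = side q \<and> pos p < pos q \<and>
     (\<forall>r\<in>P. side r = side p \<longrightarrow> \<not> (pos p < pos r \<and> pos r < pos q))"

lemma nxt_in_P: "p \<in> P \<Longrightarrow> nxt p \<in> P"
  using nxt_image by blast

text \<open>A point strictly between the two images has a predecessor. If that lies on the side of
  \<open>p\<close>, order reversal places it between \<open>p\<close> and \<open>q\<close>; if it
  lies on another side, \<open>nxt_separates\<close> puts its image outside the interval.\<close>

lemma neighbours_nxt:
  assumes "neighbours p q" "side (nxt p) = side (nxt q)"
  shows "neighbours (nxt q) (nxt p)"
proof -
  have pq: "p \<in> P" "q \<in> P" "side p = side q" "pos p < pos q"
    and adj: "\<And>r. r \<in> P \<Longrightarrow> side r = side p \<Longrightarrow> \<not> (pos p < pos r \<and> pos r < pos q)"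
    using assms(1) by (auto simp: neighbours_def)
  have False if r: "r \<in> P" "side r = side (nxt q)" "pos (nxt q) < pos r" "pos r < pos (nxt p)" for r
  proof -
    obtain r' where r': "r' \<in> P" "r = nxt r'" using r(1) nxt_image by blast
    have same: "side (nxt r') = side (nxt p)" "side (nxt r') = side (nxt q)"
      using r(2) r'(2) assms(2) by auto
    show False
    proof (cases "side r' = side p")
      case True
      have "\<not> pos r' \<le> pos p"
        using nxt_reverses[OF r'(1) pq(1) True same(1)] pos_inj[OF r'(1) pq(1) True] r(4) r'(2)
        by fastforce
      moreover have "\<not> pos q \<le> pos r'"
        using nxt_reverses[OF pq(2) r'(1)] pos_inj[OF r'(1) pq(2)] True pq(3) same(2) r(3) r'(2)
        by fastforce
      ultimately show False using adj[OF r'(1) True] by auto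
    next
      case False
      \<comment> \<open>One side is reached from two different sides, so one of the choices is +1
        and the other +2.\<close>
      then consider "side (nxt r') = side r' + 1" "side (nxt p) = side p + 2"
        | "side (nxt r') = side r' + 2" "side (nxt p) = side p + 1"
        using side_nxt[OF r'(1)] side_nxt[OF pq(1)] same(1) by auto
      then show False
      proof cases
        case 1
        then show False
          using nxt_separates[OF r'(1) pq(2) same(2)] assms(2) pq(3) r(3) r'(2) by auto
      next
        case 2
        then show False
          using nxt_separates[OF pq(1) r'(1)] same(1) r(4) r'(2) by auto
      qed
    qed
  qed
  then show ?thesis
    using pq assms(2) nxt_reverses[OF pq(1-3) assms(2) pq(4)] nxt_in_P
    unfolding neighbours_def by metis
qed

text \<open>Along a side all choices +1 precede all choices +2, so a neighbour pair with different
  choices consists of the last point of the first kind and the first point of the second.\<close>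

lemma neighbours_split_unique:
  assumes "neighbours p q" "side (nxt p) \<noteq> side (nxt q)"
    and "neighbours p' q'" "side (nxt p') \<noteq> side (nxt q')"
    and "side p = side p'"
  shows "p = p' \<and> q = q'"
proof -
  have split: "side (nxt a) = side a + 1 \<and> side (nxt b) = side a + 2"
    if "neighbours a b" "side (nxt a) \<noteq> side (nxt b)" for a b
    using that side_nxt[of a] side_nxt[of b] side_nxt_mono[of a b] by (auto simp: neighbours_def)
  note s = split[OF assms(1,2)] split[OF assms(3,4)]
  have less: "pos a < pos b"
    if "a \<in> P" "b \<in> P" "side a = side b" "side (nxt a) = side a + 1" "side (nxt b) = side b + 2"
    for a b
    using that side_nxt_mono[of b a] pos_inj[of a b] by (metis cyclic_3_distinct(3) linorder_neqE)
  have in_P: "p \<in> P" "q \<in> P" "p' \<in> P" "q' \<in> P" "side q = side p" "side p' = side p"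
    "side q' = side p"
    using assms by (auto simp: neighbours_def)
  have lt: "pos p < pos q'" "pos p' < pos q" "pos p < pos q" "pos p' < pos q'"
    by (rule less; use s in_P in simp)+
  have nb: "\<not> (pos p < pos r \<and> pos r < pos q)" "\<not> (pos p' < pos r \<and> pos r < pos q')"
    if "r \<in> P" "side r = side p" for r
    using that assms(1,3,5) by (auto simp: neighbours_def)
  have "pos p = pos p'" "pos q = pos q'"
    using nb(1)[of p'] nb(2)[of p] nb(1)[of q'] nb(2)[of q] in_P lt by force+
  then show ?thesis using in_P pos_inj by metis
qed

text \<open>Among the finitely many neighbour pairs joining the same two orbits, one with the
  smallest quotient of positions must have different choices: otherwise its image would be such a
  pair with a smaller quotient.\<close>

lemma neighbours_split_exists:
  assumes "neighbours p q"
  shows "\<exists>p' q'. neighbours p' q' \<and> side (nxt p') \<noteq> side (nxt q') \<and> {orb p', orb q'} = {orb p, orb q}"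
proof -
  define A where "A = {(a, b). neighbours a b \<and> {orb a, orb b} = {orb p, orb q}}"
  have "A \<subseteq> P \<times> P" by (auto simp: A_def neighbours_def)
  then have "finite A" using finite_P finite_subset by blast
  moreover have "A \<noteq> {}" using assms by (auto simp: A_def)
  ultimately obtain z where z: "is_arg_min (\<lambda>(a, b). pos b / pos a) (\<lambda>z. z \<in> A) z"
    using ex_is_arg_min_if_finite by blast
  obtain a b where ab: "z = (a, b)" by fastforce
  have nab: "neighbours a b" "{orb a, orb b} = {orb p, orb q}" and
    min: "\<And>a' b'. (a', b') \<in> A \<Longrightarrow> \<not> pos b' / pos a' < pos b / pos a"
    using z ab by (auto simp: is_arg_min_def A_def)
  have P: "a \<in> P" "b \<in> P" "side a = side b" "pos a < pos b" using nab by (auto simp: neighbours_def)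
  have "side (nxt a) \<noteq> side (nxt b)"
  proof
    assume eq: "side (nxt a) = side (nxt b)"
    \<comment> \<open>The images appear in reversed order; comparing unordered pairs of orbits
      absorbs the swap.\<close>
    have "(nxt b, nxt a) \<in> A"
      using neighbours_nxt[OF nab(1) eq] nab(2) orb_nxt P by (auto simp: A_def insert_commute)
    then show False using min nxt_contracts[OF P(1-3) eq P(4)] by blast
  qed
  then show ?thesis using nab by blast
qed

text \<open>Successive points lie on different sides, so each orbit occupies at least two of the
  three sides, and two such pairs of sides intersect.\<close>

lemma common_side:
  assumes "p \<in> P" "q \<in> P"
  shows "\<exists>p'\<in>P. \<exists>q'\<in>P. orb p' = orb p \<and> orb q' = orb q \<and> side p' = side q'"
proof -
  have "side (nxt p) \<noteq> side p" "side (nxt q) \<noteq> side q" using side_nxt assms by fastforce+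
  then have "side p = side q \<or> side p = side (nxt q) \<or> side (nxt p) = side q \<or> side (nxt p) = side (nxt q)"
    using exhaust_3[of "side p"] exhaust_3[of "side q"] exhaust_3[of "side (nxt p)"]
      exhaust_3[of "side (nxt q)"] by metis
  then show ?thesis using assms nxt_in_P orb_nxt by metis
qed

text \<open>On a common side, take a pair of points across the cut at minimal distance. Any point
  between them would form a closer pair across the cut with one of the two.\<close>

lemma neighbours_across_cut:
  assumes "p \<in> P" "q \<in> P" "orb p \<in> C" "orb q \<notin> C"
  shows "\<exists>a b. neighbours a b \<and> (orb a \<in> C \<longleftrightarrow> orb b \<notin> C)"
proof -
  define A where "A = {(a, b). a \<in> P \<and> b \<in> P \<and> side a = side b \<and> pos a < pos b \<and> (orb a \<in> C \<longleftrightarrow> orb b \<notin> C)}"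
  have "A \<subseteq> P \<times> P" by (auto simp: A_def)
  then have "finite A" using finite_P finite_subset by blast
  moreover have "A \<noteq> {}"
  proof -
    obtain a b where ab: "a \<in> P" "b \<in> P" "orb a = orb p" "orb b = orb q" "side a = side b"
      using common_side[OF assms(1,2)] by blast
    then have "pos a \<noteq> pos b" using pos_inj assms by metis
    then have "(a, b) \<in> A \<or> (b, a) \<in> A" using ab assms by (auto simp: A_def)
    then show ?thesis by blast
  qed
  ultimately obtain z where z: "is_arg_min (\<lambda>(a, b). pos b - pos a) (\<lambda>z. z \<in> A) z"
    using ex_is_arg_min_if_finite by blast
  obtain a b where ab: "z = (a, b)" by fastforce
  have abA: "(a, b) \<in> A" and
    min: "\<And>a' b'. (a', b') \<in> A \<Longrightarrow> \<not> pos b' - pos a' < pos b - pos a"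
    using z ab by (auto simp: is_arg_min_def)
  have False if "r \<in> P" "side r = side a" "pos a < pos r" "pos r < pos b" for r
  proof -
    have "(a, r) \<in> A \<or> (r, b) \<in> A" using abA that by (auto simp: A_def)
    then show False using min that by fastforce
  qed
  then have "neighbours a b" using abA by (auto simp: A_def neighbours_def)
  then show ?thesis using abA by (auto simp: A_def)
qed

theorem card_orbits_le_4: "card (orb ` P) \<le> 4"
proof -
  \<comment> \<open>\<open>E i\<close> holds the edges realised around the decision point of side
    \<open>i\<close>: at most one, since the pair is unique. A pair within a single orbit
    contributes a singleton, which is harmless for the count.\<close>
  define E where "E i = {{orb p, orb q} | p q. neighbours p q \<and> side p = i \<and> side (nxt p) \<noteq> side (nxt q)}" for i
  have E_le: "finite (E i) \<and> card (E i) \<le> 1" for i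
  proof -
    have "\<exists>e. E i \<subseteq> {e}"
    proof (cases "E i = {}")
      case False
      then obtain e where "e \<in> E i" by blast
      moreover have "e' = e" if "e' \<in> E i" for e'
        using that \<open>e \<in> E i\<close> neighbours_split_unique unfolding E_def by blast
      ultimately show ?thesis by blast
    qed auto
    then show ?thesis by (metis card.empty card_1_singleton_iff finite.simps le_refl subset_singletonD zero_le_one One_nat_def)
  qed
  have "card (orb ` P) \<le> Suc (card (\<Union>i. E i))"
  proof (rule card_le_Suc_card_edges)
    show "finite (orb ` P)" using finite_P by simp
    show "finite (\<Union>i. E i)" using E_le by auto
    fix C assume C: "C \<subseteq> orb ` P" "C \<noteq> {}" "C \<noteq> orb ` P"
    then obtain p q where "p \<in> P" "q \<in> P" "orb p \<in> C" "orb q \<notin> C" by blast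
    then obtain a b where ab: "neighbours a b" "orb a \<in> C \<longleftrightarrow> orb b \<notin> C"
      using neighbours_across_cut by blast
    obtain a' b' where ab': "neighbours a' b'" "side (nxt a') \<noteq> side (nxt b')"
      "{orb a', orb b'} = {orb a, orb b}"
      using neighbours_split_exists[OF ab(1)] by blast
    then have E: "{orb a, orb b} \<in> (\<Union>i. E i)" unfolding E_def by blast
    have "a \<in> P" "b \<in> P" using ab by (auto simp: neighbours_def)
    then show "\<exists>a\<in>C. \<exists>b\<in>orb ` P - C. {a, b} \<in> (\<Union>i. E i)"
      using E ab(2) by (metis DiffI image_eqI insert_commute)
  qed
  also have "card (\<Union>i. E i) \<le> (\<Sum>i\<in>UNIV. card (E i))" by (rule card_UN_le) simp
  also have "\<dots> \<le> (\<Sum>i\<in>(UNIV :: 3 set). 1)" using E_le by (intro sum_mono) auto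
  finally show ?thesis by simp
qed

end

section \<open>The triangle process in ratio coordinates\<close>

text \<open>The relative interior of the side \<open>A0i i\<close>. The service maps land here, so
  periodic orbits avoid the vertices and ratios on them are finite and positive.\<close>

definition open_side :: "3 \<Rightarrow> (real^3) set" where
  "open_side i = {z. z$i = 0 \<and> 0 < z$(i + 1) \<and> 0 < z$(i + 2) \<and> z$(i + 1) + z$(i + 2) = 1}"

text \<open>At \<open>side_pt x i\<close> this is x/(1-x), which increases with x on [0,1); the
  decision point becomes the threshold \<open>d$i / (1 - d$i)\<close>.\<close>

definition odds :: "3 \<Rightarrow> real^3 \<Rightarrow> real" where
  "odds i z = z$(i + 2) / z$(i + 1)"

lemma odds_pos: "z \<in> open_side i \<Longrightarrow> 0 < odds i z"
  by (simp add: open_side_def odds_def)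

lemma open_side_unique: "z \<in> open_side i \<Longrightarrow> z \<in> open_side j \<Longrightarrow> i = j"
  using exhaust_cyclic_3[of j i] by (auto simp: open_side_def)

lemma odds_inj:
  assumes "z \<in> open_side i" "w \<in> open_side i" "odds i z = odds i w"
  shows "z = w"
proof -
  have "z$(i + 2) * w$(i + 1) = w$(i + 2) * z$(i + 1)"
    using assms by (auto simp: open_side_def odds_def field_simps)
  moreover have "z$(i + 1) = 1 - z$(i + 2)" "w$(i + 1) = 1 - w$(i + 2)"
    using assms by (auto simp: open_side_def)
  ultimately have "z$(i + 2) * (1 - w$(i + 2)) = w$(i + 2) * (1 - z$(i + 2))" by metis
  then have "z$(i + 2) = w$(i + 2)" by (simp add: algebra_simps)
  then have "\<forall>l. z$l = w$l"
    using assms by (auto simp: all_cyclic_3[of _ i] open_side_def)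
  then show ?thesis by (simp add: vec_eq_iff)
qed

locale triangle_process =
  fixes lam mu d :: "real^3"
  assumes lam_pos: "0 < lam$i"
    and lam_less_mu: "lam$i < mu$i"
    and d_pos: "0 < d$i" and d_less_1: "d$i < 1"
begin

section \<open>Service maps and switching rule in terms of ratios\<close>

lemma denominator_eq:
  "(mu$j - lam$j) + mu$j * theta lam mu j * x
     = (mu$j - lam$j) * (1 - x) + (lam$(j + 1) + lam$(j + 2)) * x"
proof -
  have "mu$j \<noteq> 0" using lam_pos[of j] lam_less_mu[of j] by linarith
  then show ?thesis unfolding theta_def sum_cyclic_3[of _ j] by (simp add: field_simps)
qed

lemma fmap_open_side:
  assumes "z \<in> A0" "z \<notin> A0i j"
  shows "fmap lam mu j z \<in> open_side j"
    and "odds j (fmap lam mu j z) = ((mu$j - lam$j) * z$(j + 2) + lam$(j + 2) * z$j)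
      / ((mu$j - lam$j) * z$(j + 1) + lam$(j + 1) * z$j)"
proof -
  have nonneg: "\<And>l. 0 \<le> z$l" and sum: "z$j + z$(j + 1) + z$(j + 2) = 1"
    using assms(1) by (auto simp: A0_def A0i_def sum_cyclic_3[of _ j])
  have "z$j \<noteq> 0" using assms(2) nonneg sum by (auto simp: A0i_def sum_cyclic_3[of _ j])
  then have pos: "0 < z$j" using nonneg[of j] by simp
  define D where "D = (mu$j - lam$j) + mu$j * theta lam mu j * z$j"
  define N where "N l = (mu$j - lam$j) * z$l + lam$l * z$j" for l
  have N: "0 < N l" for l
    unfolding N_def using nonneg[of l] pos lam_pos[of l] lam_less_mu[of j]
    by (intro add_nonneg_pos mult_nonneg_nonneg mult_pos_pos) auto
  \<comment> \<open>The denominator of \<open>fmap\<close> is the sum of its two numerators. Hence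
    the image has coordinate sum 1, and the denominator cancels from the ratio.\<close>
  have ND: "N (j + 1) + N (j + 2) = D"
  proof -
    have "1 - z$j = z$(j + 1) + z$(j + 2)" using sum by simp
    then show ?thesis unfolding D_def denominator_eq N_def by (simp add: distrib_left distrib_right)
  qed
  have D: "0 < D" using N[of "j + 1"] N[of "j + 2"] ND by linarith
  have f: "fmap lam mu j z $ l = (if l = j then 0 else N l / D)" for l
    by (simp add: fmap_def N_def D_def)
  show "fmap lam mu j z \<in> open_side j"
    using N D ND by (simp add: open_side_def f flip: add_divide_distrib)
  show "odds j (fmap lam mu j z) = ((mu$j - lam$j) * z$(j + 2) + lam$(j + 2) * z$j)
      / ((mu$j - lam$j) * z$(j + 1) + lam$(j + 1) * z$j)"
    using D by (simp add: odds_def f flip: N_def)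
qed

lemma phi_step_open_side: "phi_step lam mu d z w \<Longrightarrow> \<exists>j. w \<in> open_side j"
  using fmap_open_side(1) unfolding phi_step_def by blast

text \<open>An interior point has exactly one zero coordinate, which determines its side. Both
  inequalities are weak because the rule is two-valued at the decision point.\<close>

lemma rule_allows_open_side:
  assumes "z \<in> open_side i" "rule_allows d z j"
  shows "(j = i + 1 \<and> odds i z \<le> d$i / (1 - d$i)) \<or> (j = i + 2 \<and> d$i / (1 - d$i) \<le> odds i z)"
proof -
  obtain i' x where x: "0 \<le> x" "x \<le> 1" "z = side_pt x i'" and
    j: "(x < d$i' \<and> j = i' + 1) \<or> (x > d$i' \<and> j = i' + 2) \<or> (x = d$i' \<and> (j = i' + 1 \<or> j = i' + 2))"
    using assms(2) unfolding rule_allows_def by blast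
  have z: "z$i = 0" "0 < z$(i + 1)" "0 < z$(i + 2)" using assms(1) by (auto simp: open_side_def)
  have "z$i' = 0" using x(3) by (simp add: side_pt_def)
  then have [simp]: "i' = i" using z exhaust_cyclic_3[of i' i] by auto
  have "0 < 1 - x" using z(2) x(3) by (simp add: side_pt_def)
  moreover have "odds i z = x / (1 - x)" using x(3) by (simp add: odds_def side_pt_def)
  moreover have "0 < 1 - d$i" using d_less_1[of i] by simp
  moreover have "u / (1 - u) \<le> v / (1 - v)" if "0 \<le> u" "u \<le> v" "0 < 1 - v" for u v :: real
    using that by (intro frac_le) auto
  ultimately show ?thesis using j x(1) d_pos[of i] by auto
qed

text \<open>As \<open>z$i\<close> vanishes, the ratio of the image is a quotient of two linear forms
  in the other two coordinates. Dividing both by the coordinate of the queue being served leaves a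
  function of \<open>odds i z\<close>.\<close>

lemma phi_step_cases:
  assumes "z \<in> open_side i" "phi_step lam mu d z w"
  obtains "w \<in> open_side (i + 1)" "odds i z \<le> d$i / (1 - d$i)"
      "odds (i + 1) w = lam$i / ((mu$(i + 1) - lam$(i + 1)) * odds i z + lam$(i + 2))"
    | "w \<in> open_side (i + 2)" "d$i / (1 - d$i) \<le> odds i z"
      "odds (i + 2) w = ((mu$(i + 2) - lam$(i + 2)) / odds i z + lam$(i + 1)) / lam$i"
proof -
  obtain j where j: "z \<in> A0" "rule_allows d z j" "z \<notin> A0i j" "w = fmap lam mu j z"
    using assms(2) unfolding phi_step_def by blast
  note f = fmap_open_side[OF j(1,3), folded j(4)]
  have z: "z$i = 0" "0 < z$(i + 1)" "0 < z$(i + 2)" using assms(1) by (auto simp: open_side_def)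
  from rule_allows_open_side[OF assms(1) j(2)] show ?thesis
  proof (elim disjE conjE)
    assume [simp]: "j = i + 1" and le: "odds i z \<le> d$i / (1 - d$i)"
    have "(mu$(i + 1) - lam$(i + 1)) * z$(i + 2) + lam$(i + 2) * z$(i + 1)
        = ((mu$(i + 1) - lam$(i + 1)) * odds i z + lam$(i + 2)) * z$(i + 1)"
    proof -
      have "odds i z * z$(i + 1) = z$(i + 2)" using z by (simp add: odds_def)
      then show ?thesis by (simp only: distrib_right mult.assoc)
    qed
    then have "odds (i + 1) w = lam$i / ((mu$(i + 1) - lam$(i + 1)) * odds i z + lam$(i + 2))"
      using f(2) z by simp
    then show ?thesis using that(1) f(1) le by simp
  next
    assume [simp]: "j = i + 2" and le: "d$i / (1 - d$i) \<le> odds i z"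
    have "b * z$(i + 1) + c * z$(i + 2) = (b / odds i z + c) * z$(i + 2)" for b c
    proof -
      have "b / odds i z * z$(i + 2) = b * z$(i + 1)" using z by (simp add: odds_def)
      then show ?thesis by (simp only: distrib_right)
    qed
    then have "odds (i + 2) w = ((mu$(i + 2) - lam$(i + 2)) / odds i z + lam$(i + 1)) / lam$i"
      using f(2) z by simp
    then show ?thesis using that(2) f(1) le by simp
  qed
qed

section \<open>Order, contraction and injectivity of one step\<close>

lemma phi_step_side:
  assumes "z \<in> open_side i" "phi_step lam mu d z w" "w \<in> open_side j"
  shows "j = i + 1 \<or> j = i + 2"
  using assms(3) by (rule_tac phi_step_cases[OF assms(1,2)]) (auto dest: open_side_unique)

lemma phi_step_side_1:
  assumes "z \<in> open_side i" "phi_step lam mu d z w" "w \<in> open_side (i + 1)"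
  shows "odds i z \<le> d$i / (1 - d$i)"
    and "odds (i + 1) w = lam$i / ((mu$(i + 1) - lam$(i + 1)) * odds i z + lam$(i + 2))"
proof -
  have not: "w \<notin> open_side (i + 2)" using open_side_unique[OF assms(3)] by fastforce
  show "odds i z \<le> d$i / (1 - d$i)"
    by (rule phi_step_cases[OF assms(1,2)]) (use not in simp_all)
  show "odds (i + 1) w = lam$i / ((mu$(i + 1) - lam$(i + 1)) * odds i z + lam$(i + 2))"
    by (rule phi_step_cases[OF assms(1,2)]) (use not in simp_all)
qed

lemma phi_step_side_2:
  assumes "z \<in> open_side i" "phi_step lam mu d z w" "w \<in> open_side (i + 2)"
  shows "d$i / (1 - d$i) \<le> odds i z"
    and "odds (i + 2) w = ((mu$(i + 2) - lam$(i + 2)) / odds i z + lam$(i + 1)) / lam$i"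
proof -
  have not: "w \<notin> open_side (i + 1)" using open_side_unique[OF assms(3)] by fastforce
  show "d$i / (1 - d$i) \<le> odds i z"
    by (rule phi_step_cases[OF assms(1,2)]) (use not in simp_all)
  show "odds (i + 2) w = ((mu$(i + 2) - lam$(i + 2)) / odds i z + lam$(i + 1)) / lam$i"
    by (rule phi_step_cases[OF assms(1,2)]) (use not in simp_all)
qed

text \<open>Contraction holds because adding a positive constant to two positive numbers pulls their
  quotient towards 1: the constant is added to b*t and b*t' for one choice, and to b/t and b/t' for
  the other.\<close>

lemma phi_step_reverses_contracts:
  assumes "z \<in> open_side i" "z' \<in> open_side i" "phi_step lam mu d z w" "phi_step lam mu d z' w'"
    and "w \<in> open_side j" "w' \<in> open_side j" "odds i z < odds i z'"
  shows "odds j w' < odds j w" "odds j w / odds j w' < odds i z' / odds i z"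
proof -
  have t: "0 < odds i z" "0 < odds i z'" using assms odds_pos by blast+
  have ji: "j = i + 1 \<or> j = i + 2" using phi_step_side assms(1,3,5) by blast
  have "odds j w' < odds j w \<and> odds j w / odds j w' < odds i z' / odds i z"
  proof (rule disjE[OF ji])
    assume j: "j = i + 1"
    define b where "b = mu$(i + 1) - lam$(i + 1)"
    have pos: "0 < b" "0 < lam$(i + 2)" "0 < lam$i"
      using lam_pos lam_less_mu[of "i + 1"] by (auto simp: b_def)
    have w: "odds j w = lam$i / (b * odds i z + lam$(i + 2))"
      "odds j w' = lam$i / (b * odds i z' + lam$(i + 2))"
      using phi_step_side_1(2)[OF assms(1,3)] phi_step_side_1(2)[OF assms(2,4)] assms(5,6)
      by (simp_all only: b_def j)
    have less: "b * odds i z + lam$(i + 2) < b * odds i z' + lam$(i + 2)" using pos assms(7) by simp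
    have den: "0 < b * odds i z + lam$(i + 2)" using pos t by (simp add: add_pos_pos)
    have "odds j w' < odds j w"
      unfolding w using less den pos by (intro divide_strict_left_mono mult_pos_pos) linarith+
    moreover have "odds j w / odds j w' = (b * odds i z' + lam$(i + 2)) / (b * odds i z + lam$(i + 2))"
      unfolding w using pos by simp
    moreover have "\<dots> < odds i z' / odds i z"
      using den t pos assms(7) by (simp add: divide_less_eq less_divide_eq algebra_simps)
    ultimately show ?thesis by simp
  next
    assume j: "j = i + 2"
    define b where "b = mu$(i + 2) - lam$(i + 2)"
    have pos: "0 < b" "0 < lam$(i + 1)" "0 < lam$i"
      using lam_pos lam_less_mu[of "i + 2"] by (auto simp: b_def)
    have w: "odds j w = (b / odds i z + lam$(i + 1)) / lam$i"
      "odds j w' = (b / odds i z' + lam$(i + 1)) / lam$i"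
      using phi_step_side_2(2)[OF assms(1,3)] phi_step_side_2(2)[OF assms(2,4)] assms(5,6)
      by (simp_all only: b_def j)
    have "b / odds i z' < b / odds i z"
      using t pos assms(7) by (intro divide_strict_left_mono mult_pos_pos) auto
    then have "odds j w' < odds j w" unfolding w using pos by (intro divide_strict_right_mono) auto
    moreover have "odds j w / odds j w' = (b / odds i z + lam$(i + 1)) / (b / odds i z' + lam$(i + 1))"
      unfolding w using pos by simp
    moreover have "\<dots> < odds i z' / odds i z"
    proof -
      have "0 < b / odds i z' + lam$(i + 1)" using pos t by (simp add: add_pos_pos)
      moreover have "odds i z' / odds i z * (b / odds i z' + lam$(i + 1))
          = b / odds i z + lam$(i + 1) * (odds i z' / odds i z)"
        using t by (simp add: field_simps)
      moreover have "lam$(i + 1) < lam$(i + 1) * (odds i z' / odds i z)"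
        using t pos assms(7) by (simp add: less_divide_eq)
      ultimately show ?thesis by (simp only: pos_divide_less_eq)
    qed
    ultimately show ?thesis by simp
  qed
  then show "odds j w' < odds j w" "odds j w / odds j w' < odds i z' / odds i z" by auto
qed

text \<open>The image of the vertex with coordinate \<open>j\<close> equal to 1, whose odds are
  \<open>lam$(j+2) / lam$(j+1)\<close>, separates the images of the two sides adjacent to it.\<close>

lemma phi_step_separates:
  assumes "z \<in> open_side (j + 2)" "z' \<in> open_side (j + 1)"
    and "phi_step lam mu d z w" "phi_step lam mu d z' w'" "w \<in> open_side j" "w' \<in> open_side j"
  shows "odds j w < odds j w'"
proof -
  have t: "0 < odds (j + 2) z" "0 < odds (j + 1) z'" using assms odds_pos by blast+
  have pos: "0 < lam$(j + 1)" "0 < lam$(j + 2)" "0 < mu$j - lam$j"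
    using lam_pos lam_less_mu[of j] by auto
  have w: "odds j w = lam$(j + 2) / ((mu$j - lam$j) * odds (j + 2) z + lam$(j + 1))"
    using phi_step_side_1(2)[OF assms(1,3)] assms(5) by simp
  have w': "odds j w' = ((mu$j - lam$j) / odds (j + 1) z' + lam$(j + 2)) / lam$(j + 1)"
    using phi_step_side_2(2)[OF assms(2,4)] assms(6) by simp
  have "odds j w < lam$(j + 2) / lam$(j + 1)"
    unfolding w using pos t by (intro divide_strict_left_mono mult_pos_pos add_pos_pos) auto
  also have "\<dots> < odds j w'"
    unfolding w' using pos t by (intro divide_strict_right_mono) auto
  finally show ?thesis .
qed

text \<open>Images from the two different adjacent sides are separated, and on one side a fixed
  choice is strictly monotone. So predecessors are unique although successors need not be.\<close>

lemma phi_step_inj: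
  assumes "z \<in> open_side i" "z' \<in> open_side i'" "phi_step lam mu d z w" "phi_step lam mu d z' w"
  shows "z = z'"
proof -
  obtain j where j: "w \<in> open_side j" using phi_step_open_side assms(3) by blast
  have ji: "i = j + 2 \<or> i = j + 1" if "z \<in> open_side i" "phi_step lam mu d z w" for z i
    using phi_step_side[OF that j] by auto
  have "i = i'"
    using ji[OF assms(1,3)] ji[OF assms(2,4)] phi_step_separates[of _ j] assms j
    by (metis order_less_irrefl)
  then have "odds i z = odds i z'"
    using phi_step_reverses_contracts(1)[OF _ _ _ _ j j] assms
    by (metis linorder_neqE order_less_irrefl)
  then show ?thesis using odds_inj assms \<open>i = i'\<close> by metis
qed

section \<open>Periodic orbits\<close>

lemma periodic_orbit_step:
  assumes "periodic_orbit lam mu d us"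
  shows "phi_step lam mu d (us ! (n mod length us)) (us ! (Suc n mod length us))"
proof (cases "Suc (n mod length us) = length us")
  case True
  then have "Suc n mod length us = 0" by (metis mod_Suc)
  then show ?thesis
    using assms True by (metis periodic_orbit_def hd_conv_nth last_conv_nth diff_Suc_1)
next
  case False
  have "n mod length us < length us" using assms by (simp add: periodic_orbit_def)
  then have "Suc (n mod length us) < length us" "Suc n mod length us = Suc (n mod length us)"
    using False by (auto simp: mod_Suc)
  then show ?thesis using assms by (simp add: periodic_orbit_def)
qed

lemma periodic_orbit_open_side:
  assumes "periodic_orbit lam mu d us" "n < length us"
  shows "\<exists>i. us ! n \<in> open_side i"
proof -
  \<comment> \<open>The cyclic predecessor of index \<open>n\<close> is reached by adding
    \<open>length us - 1\<close>, which also covers \<open>n = 0\<close>.\<close>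
  have "Suc (n + (length us - 1)) = n + length us" using assms(2) by simp
  then have "Suc (n + (length us - 1)) mod length us = n" using assms(2) by simp
  then show ?thesis
    using periodic_orbit_step[OF assms(1), of "n + (length us - 1)"] phi_step_open_side by metis
qed

text \<open>A shared point determines the whole past of both orbits, and by periodicity the past is
  everything.\<close>

lemma periodic_orbits_disjoint:
  assumes us: "periodic_orbit lam mu d us" and vs: "periodic_orbit lam mu d vs"
    and nm: "n < length us" "m < length vs" "us ! n = vs ! m"
  shows "\<exists>k. us = rotate k vs"
proof -
  define a b where "a = length us" and "b = length vs"
  define U V where "U k = us ! ((n + k) mod a)" and "V k = vs ! ((m + k) mod b)" for k
  have ab: "0 < a" "0 < b" using nm by (auto simp: a_def b_def)
  have pred: "U k = V k" if "U (Suc k) = V (Suc k)" for k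
  proof -
    have "phi_step lam mu d (U k) (U (Suc k))" "phi_step lam mu d (V k) (V (Suc k))"
      using periodic_orbit_step[OF us, of "n + k"] periodic_orbit_step[OF vs, of "m + k"]
      by (simp_all add: U_def V_def a_def b_def)
    moreover have "\<exists>i. U k \<in> open_side i" "\<exists>i. V k \<in> open_side i"
      using periodic_orbit_open_side[OF us] periodic_orbit_open_side[OF vs] ab
      by (simp_all add: U_def V_def a_def b_def)
    ultimately show ?thesis using phi_step_inj that by metis
  qed
  \<comment> \<open>Agreement propagates only backwards. The index \<open>k * a * b\<close> is a
    multiple of both periods, so the sequences agree there, and descending from it reaches
    \<open>k\<close>.\<close>
  have eq: "U k = V k" for k
  proof -
    have "k * a * b = a * (k * b)" "k * a * b = b * (k * a)" by simp_all
    then have "(n + k * a * b) mod a = n" "(m + k * a * b) mod b = m"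
      using nm by (metis a_def mod_less mod_mult_self2, metis b_def mod_less mod_mult_self2)
    then have "U (k * a * b) = V (k * a * b)" using nm(3) by (simp add: U_def V_def)
    moreover have "k \<le> k * a * b" using ab by (simp add: mult.assoc)
    ultimately show ?thesis by (rule_tac inc_induct[of k "k * a * b"]) (use pred in auto)
  qed
  \<comment> \<open>The entries of each list are distinct, so \<open>U\<close> and \<open>V\<close>
    return to their common starting point exactly at the multiples of \<open>a\<close> and of
    \<open>b\<close>; equal sequences thus force \<open>a = b\<close>.\<close>
  have "(x + k) mod c = x \<longleftrightarrow> c dvd k" if "x < c" for x k c :: nat
    using that mod_eq_dvd_iff_nat[of x "x + k" c] by simp
  then have "(n + k) mod a = n \<longleftrightarrow> a dvd k" "(m + k) mod b = m \<longleftrightarrow> b dvd k" for k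
    using nm(1,2) by (simp_all only: a_def b_def)
  moreover have "U k = us ! n \<longleftrightarrow> (n + k) mod a = n" "V k = vs ! m \<longleftrightarrow> (m + k) mod b = m" for k
    using us vs nm(1,2) ab
    by (simp_all only: periodic_orbit_def U_def V_def a_def b_def nth_eq_iff_index_eq mod_less_divisor)
  ultimately have "a dvd k \<longleftrightarrow> b dvd k" for k using eq nm(3) by metis
  then have "a = b" by (metis dvd_antisym dvd_refl)
  have "rotate n us = rotate m vs"
    using eq \<open>a = b\<close> by (intro nth_equalityI) (auto simp: a_def b_def U_def V_def nth_rotate)
  then have "rotate (length us - n) (rotate n us) = rotate (length us - n + m) vs"
    by (simp add: rotate_rotate)
  then have "us = rotate (length us - n + m) vs" using nm(1) by (simp add: rotate_rotate)
  then show ?thesis by blast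
qed

lemma card_periodic_orbits_le_4:
  assumes "finite S" and orbit: "\<And>us. us \<in> S \<Longrightarrow> periodic_orbit lam mu d us"
    and distinct: "\<And>us vs k. us \<in> S \<Longrightarrow> vs \<in> S \<Longrightarrow> us = rotate k vs \<Longrightarrow> us = vs"
  shows "card S \<le> 4"
proof -
  \<comment> \<open>Points are tagged with their orbit and index. This makes \<open>fst\<close> the
    orbit label and the successor single-valued even at a decision point.\<close>
  define P where "P = (SIGMA us:S. {..<length us})"
  define pt where "pt = (\<lambda>(us, n). us ! n :: real^3)"
  define nxt where "nxt = (\<lambda>(us, n). (us :: (real^3) list, Suc n mod length us))"
  define side where "side p = (SOME i. pt p \<in> open_side i)" for p
  define pos where "pos p = odds (side p) (pt p)" for p
  have ne: "us \<noteq> []" if "us \<in> S" for us using orbit[OF that] by (simp add: periodic_orbit_def)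
  have side: "pt p \<in> open_side (side p)" if "p \<in> P" for p
  proof -
    have "\<exists>i. pt p \<in> open_side i"
      using that periodic_orbit_open_side[OF orbit, of "fst p" "snd p"] by (auto simp: P_def pt_def)
    then show ?thesis unfolding side_def by (rule someI_ex)
  qed
  have nxt_P: "nxt p \<in> P" if "p \<in> P" for p using that ne by (auto simp: P_def nxt_def)
  have step: "phi_step lam mu d (pt p) (pt (nxt p))" if "p \<in> P" for p
    using that periodic_orbit_step[OF orbit, of "fst p" "snd p"] by (auto simp: P_def pt_def nxt_def)
  \<comment> \<open>Nothing is lost by tagging: different orbits of \<open>S\<close> are disjoint,
    and no orbit repeats a point.\<close>
  have pt_inj: "p = q" if "p \<in> P" "q \<in> P" "pt p = pt q" for p q
  proof -
    obtain us n vs m where pq: "p = (us, n)" "q = (vs, m)" by fastforce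
    then have "us = vs"
      using that periodic_orbits_disjoint[OF orbit orbit, of us vs n m] distinct
      by (auto simp: P_def pt_def)
    then show ?thesis
      using that pq orbit[of us]
      by (auto simp: P_def pt_def periodic_orbit_def nth_eq_iff_index_eq)
  qed
  have "side_dynamics P nxt side pos fst"
  proof
    show "finite P" using assms(1) by (simp add: P_def)
    show "nxt ` P = P"
    proof
      show "nxt ` P \<subseteq> P" using nxt_P by blast
      show "P \<subseteq> nxt ` P"
      proof clarify
        fix us n assume "(us, n) \<in> P"
        then have "us \<in> S" "n < length us" by (auto simp: P_def)
        moreover from this have "Suc (n + (length us - 1)) = n + length us" by simp
        ultimately have "(us, n) = nxt (us, (n + (length us - 1)) mod length us)"
          by (simp add: nxt_def mod_Suc_eq)
        moreover have "(us, (n + (length us - 1)) mod length us) \<in> P"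
          using \<open>us \<in> S\<close> ne by (simp add: P_def)
        ultimately show "(us, n) \<in> nxt ` P" by (rule image_eqI)
      qed
    qed
    show "fst (nxt p) = fst p" for p by (simp add: nxt_def split: prod.split)
  next
    fix p assume p: "p \<in> P"
    show "0 < pos p" using side[OF p] odds_pos by (simp add: pos_def)
    show "side (nxt p) = side p + 1 \<or> side (nxt p) = side p + 2"
      using phi_step_side side step nxt_P p by blast
  next
    fix p q assume pq: "p \<in> P" "q \<in> P"
    note side_p = side[OF pq(1)] and side_q = side[OF pq(2)]
    note nxt_p = side[OF nxt_P[OF pq(1)]] and nxt_q = side[OF nxt_P[OF pq(2)]]
    show "p = q" if "side p = side q" "pos p = pos q"
      using that pt_inj[OF pq] odds_inj side_p side_q unfolding pos_def by metis
    show "side (nxt q) = side p + 2"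
      if "side p = side q" "pos p < pos q" "side (nxt p) = side p + 2"
    proof (rule ccontr)
      \<comment> \<open>The threshold of the side would lie weakly above \<open>pos q\<close> and
        weakly below \<open>pos p\<close>.\<close>
      assume "side (nxt q) \<noteq> side p + 2"
      then have "side (nxt q) = side q + 1"
        using phi_step_side[OF side_q step[OF pq(2)] nxt_q] that(1) by auto
      then have "pos q \<le> d $ side q / (1 - d $ side q)"
        using phi_step_side_1(1)[OF side_q step[OF pq(2)]] nxt_q by (simp add: pos_def)
      moreover have "d $ side p / (1 - d $ side p) \<le> pos p"
        using phi_step_side_2(1)[OF side_p step[OF pq(1)]] nxt_p that(3) by (simp add: pos_def)
      ultimately show False using that by simp
    qed
    show "pos (nxt q) < pos (nxt p)" "pos (nxt p) / pos (nxt q) < pos q / pos p"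
      if "side p = side q" "side (nxt p) = side (nxt q)" "pos p < pos q"
      using that side_p side_q nxt_p nxt_q
        phi_step_reverses_contracts[of "pt p" "side p" "pt q" "pt (nxt p)" "pt (nxt q)" "side (nxt p)"]
        step pq by (simp_all add: pos_def)
    show "pos (nxt p) < pos (nxt q)"
      if "side (nxt p) = side (nxt q)" "side (nxt p) = side p + 1" "side (nxt q) = side q + 2"
    proof -
      have "side p = side (nxt p) + 2" "side q = side (nxt p) + 1" using that by simp_all
      then show ?thesis
        using phi_step_separates[of "pt p" "side (nxt p)" "pt q" "pt (nxt p)" "pt (nxt q)"]
          that(1) side_p side_q nxt_p nxt_q step pq by (simp add: pos_def)
    qed
  qed
  then have "card (fst ` P) \<le> 4" by (rule side_dynamics.card_orbits_le_4)
  moreover have "fst ` P = S" using ne by (force simp: P_def image_iff)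
  ultimately show ?thesis by simp
qed

end

section \<open>Representatives of all periodic orbits up to cyclic shift\<close>

theorem theorem3p2:
  fixes lam mu d :: "real^3"
  assumes "\<forall>i. lam$i > 0" and "\<forall>i. mu$i > 0"
    and "\<forall>i. lam$i / mu$i < 1"
    and "(\<Sum>i\<in>UNIV. lam$i / mu$i) > 1"
    and "\<forall>i. 0 < d$i \<and> d$i < 1"
  shows "\<exists>S. finite S \<and> card S \<le> 4 \<and>
           (\<forall>us. periodic_orbit lam mu d us \<longrightarrow> (\<exists>v\<in>S. \<exists>k. us = rotate k v))"
proof -
  interpret triangle_process lam mu d
  proof
    show "0 < lam$i" "0 < d$i" "d$i < 1" for i using assms(1,5) by simp_all
    show "lam$i < mu$i" for i using assms(2,3) by (simp add: pos_divide_less_eq)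
  qed
  \<comment> \<open>A finite family of orbits that are pairwise different up to cyclic
    shift.\<close>
  define good where "good S \<longleftrightarrow> finite S \<and> (\<forall>us\<in>S. periodic_orbit lam mu d us) \<and>
    (\<forall>us\<in>S. \<forall>vs\<in>S. \<forall>k. us = rotate k vs \<longrightarrow> us = vs)" for S
  have le4: "card S \<le> 4" if "good S" for S
  proof (rule card_periodic_orbits_le_4)
    show "finite S" using that by (simp add: good_def)
    show "periodic_orbit lam mu d us" if "us \<in> S" for us
      using \<open>good S\<close> that by (simp add: good_def)
    show "us = vs" if "us \<in> S" "vs \<in> S" "us = rotate k vs" for us vs k
      using \<open>good S\<close> that unfolding good_def by blast
  qed
  have "good {}" by (simp add: good_def)
  moreover have "\<forall>T. good T \<longrightarrow> card T < 5" using le4 by fastforce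
  \<comment> \<open>The uniform bound on sizes yields a family of maximal size; an orbit that is no
    shift of a member could be added to it.\<close>
  ultimately obtain S where S: "good S" "\<And>T. good T \<Longrightarrow> card T \<le> card S"
    using ex_has_greatest_nat[of good "{}" card 5] by blast
  have "\<exists>v\<in>S. \<exists>k. us = rotate k v" if us: "periodic_orbit lam mu d us" for us
  proof (rule ccontr)
    assume no: "\<not> ?thesis"
    have "v \<noteq> rotate k us" if "v \<in> S" for v k
    proof
      assume v: "v = rotate k us"
      \<comment> \<open>The inverse rotation shows that being a cyclic shift is symmetric.\<close>
      have "us = rotate (length us - k mod length us) (rotate (k mod length us) us)"
        using us by (simp add: rotate_rotate periodic_orbit_def less_imp_le)
      then have "us = rotate (length us - k mod length us) v" using v rotate_conv_mod by metis
      then show False using no that by blast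
    qed
    moreover have "us \<noteq> rotate k v" if "v \<in> S" for v k using no that by blast
    ultimately have "good (insert us S)" using S(1) us by (auto simp: good_def)
    moreover have "us \<notin> S" using no by (metis rotate0 id_apply)
    moreover have "finite S" using S(1) by (simp add: good_def)
    ultimately show False using S(2)[of "insert us S"] by simp
  qed
  moreover have "finite S" using S(1) by (simp add: good_def)
  ultimately show ?thesis using le4[OF S(1)] by blast
qed

end
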